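(* Let $\varphi$ be an IA-automorphism of the free nilpotent group $N_{n,2}$ of nilpotency class $2$. Then the set $[e]_{\varphi}$ is a subgroup of $N_{n,2}$.
   Context: $N_{n,r}$ denotes the free nilpotent group of rank $n$ and nilpotency class $r$. An automorphism of $N_{n,r}$ is called an IA-automorphism if it acts identically modulo the derived subgroup of $N_{n,r}$. For an automorphism $\varphi$ of a group $G$, $[e]_{\varphi}=\{z^{-1}z^{\varphi}\mid z\in G\}$ is the twisted conjugacy class of the unit element $e$, where $z^\varphi$ is the image of $z$ under $\varphi$. *)

theory Defs
  imports "HOL-Algebra.Generated_Groups"
begin

text \<open>
  The free group on a set \<open>X\<close> is realised as the group of words in the letters
  \<open>(True, x)\<close> (standing for \<open>x\<close>) and \<open>(False, x)\<close> (standing for the inverse of \<open>x\<close>),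
  modulo the equivalence relation generated by the cancellation of adjacent inverse letters.
\<close>

type_synonym 'x fg_word = "(bool \<times> 'x) list"

definition fg_words :: "'x set \<Rightarrow> 'x fg_word set"
  where "fg_words X = lists (UNIV \<times> X)"

inductive_set fg_rel :: "'x set \<Rightarrow> ('x fg_word \<times> 'x fg_word) set" for X
  where
    cancel: "u \<in> fg_words X \<Longrightarrow> v \<in> fg_words X \<Longrightarrow> x \<in> X \<Longrightarrow>
      (u @ [(b, x), (\<not> b, x)] @ v, u @ v) \<in> fg_rel X"
  | refl: "u \<in> fg_words X \<Longrightarrow> (u, u) \<in> fg_rel X"
  | sym: "(u, v) \<in> fg_rel X \<Longrightarrow> (v, u) \<in> fg_rel X"
  | trans: "(u, v) \<in> fg_rel X \<Longrightarrow> (v, w) \<in> fg_rel X \<Longrightarrow> (u, w) \<in> fg_rel X"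

definition free_group :: "'x set \<Rightarrow> 'x fg_word set monoid"
  where "free_group X =
    \<lparr> carrier = fg_words X // fg_rel X,
      mult = (\<lambda>A B. \<Union>u\<in>A. \<Union>v\<in>B. fg_rel X `` {u @ v}),
      one = fg_rel X `` {[]} \<rparr>"

text \<open>
  Indices are shifted by one with respect to the usual numbering of the lower central series:
  \<open>lower_central G k\<close> is the term \<open>\<gamma>\<^sub>k\<^sub>+\<^sub>1(G)\<close>, where \<open>\<gamma>\<^sub>1(G) = G\<close> and
  \<open>\<gamma>\<^sub>k\<^sub>+\<^sub>1(G) = [\<gamma>\<^sub>k(G), G]\<close>.
\<close>

primrec lower_central :: "('a, 'b) monoid_scheme \<Rightarrow> nat \<Rightarrow> 'a set"
  where
    "lower_central G 0 = carrier G"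
  | "lower_central G (Suc k) = generate G
      (\<Union>h\<in>lower_central G k. \<Union>g\<in>carrier G.
        {h \<otimes>\<^bsub>G\<^esub> g \<otimes>\<^bsub>G\<^esub> inv\<^bsub>G\<^esub> h \<otimes>\<^bsub>G\<^esub> inv\<^bsub>G\<^esub> g})"

text \<open>
  The free nilpotent group of rank \<open>n\<close> and class \<open>r\<close> is \<open>F\<^sub>n / \<gamma>\<^sub>r\<^sub>+\<^sub>1(F\<^sub>n)\<close>.
\<close>

definition free_nilpotent_group :: "nat \<Rightarrow> nat \<Rightarrow> nat fg_word set set monoid"
  where "free_nilpotent_group n r =
    free_group {..<n} Mod lower_central (free_group {..<n}) r"

definition IA_automorphism :: "('a, 'b) monoid_scheme \<Rightarrow> ('a \<Rightarrow> 'a) \<Rightarrow> bool"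
  where "IA_automorphism G \<phi> \<longleftrightarrow> \<phi> \<in> iso G G \<and>
    (\<forall>z\<in>carrier G. derived G (carrier G) #>\<^bsub>G\<^esub> \<phi> z = derived G (carrier G) #>\<^bsub>G\<^esub> z)"

definition twisted_class_one :: "('a, 'b) monoid_scheme \<Rightarrow> ('a \<Rightarrow> 'a) \<Rightarrow> 'a set"
  where "twisted_class_one G \<phi> = {inv\<^bsub>G\<^esub> z \<otimes>\<^bsub>G\<^esub> \<phi> z | z. z \<in> carrier G}"


subsection \<open>Basic properties\<close>

lemma fg_words_append [simp]: "u @ v \<in> fg_words X \<longleftrightarrow> u \<in> fg_words X \<and> v \<in> fg_words X"
  by (auto simp: fg_words_def)

lemma fg_words_Nil [simp]: "[] \<in> fg_words X"
  by (simp add: fg_words_def)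

lemma fg_words_Cons [simp]: "(b, x) # v \<in> fg_words X \<longleftrightarrow> x \<in> X \<and> v \<in> fg_words X"
  by (auto simp: fg_words_def)

lemma fg_rel_in_words:
  assumes "(u, v) \<in> fg_rel X"
  shows "u \<in> fg_words X \<and> v \<in> fg_words X"
  using assms by induction auto

lemma equiv_fg_rel: "equiv (fg_words X) (fg_rel X)"
  by (rule equivI) (auto simp: refl_on_def sym_def trans_def
      dest: fg_rel_in_words intro: fg_rel.refl fg_rel.sym fg_rel.trans)

lemma fg_rel_append_left:
  assumes "(u, v) \<in> fg_rel X" "w \<in> fg_words X"
  shows "(w @ u, w @ v) \<in> fg_rel X"
  using assms
proof induction
  case (cancel u v x b)
  then show ?case
    using fg_rel.cancel[of "w @ u" X v x b] by simp
qed (auto intro: fg_rel.refl fg_rel.sym fg_rel.trans)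

lemma fg_rel_append_right:
  assumes "(u, v) \<in> fg_rel X" "w \<in> fg_words X"
  shows "(u @ w, v @ w) \<in> fg_rel X"
  using assms
proof induction
  case (cancel u v x b)
  then show ?case
    using fg_rel.cancel[of u X "v @ w" x b] by simp
qed (auto intro: fg_rel.refl fg_rel.sym fg_rel.trans)

lemma fg_rel_append:
  assumes "(u, u') \<in> fg_rel X" "(v, v') \<in> fg_rel X"
  shows "(u @ v, u' @ v') \<in> fg_rel X"
  using assms by (meson fg_rel.trans fg_rel_append_left fg_rel_append_right fg_rel_in_words)

lemma free_group_mult_class:
  assumes "u \<in> fg_words X" "v \<in> fg_words X"
  shows "fg_rel X `` {u} \<otimes>\<^bsub>free_group X\<^esub> fg_rel X `` {v} = fg_rel X `` {u @ v}"
proof -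
  have "fg_rel X `` {s @ t} = fg_rel X `` {u @ v}"
    if "(u, s) \<in> fg_rel X" "(v, t) \<in> fg_rel X" for s t
    using equiv_class_eq[OF equiv_fg_rel fg_rel_append[OF that]] by simp
  moreover have "(u, u) \<in> fg_rel X" "(v, v) \<in> fg_rel X"
    using assms by (auto intro: fg_rel.refl)
  ultimately show ?thesis
    unfolding free_group_def monoid.simps Image_singleton_iff by blast
qed

lemma fg_rel_inverse_word:
  assumes "w \<in> fg_words X"
  shows "rev (map (apfst Not) w) \<in> fg_words X
    \<and> (rev (map (apfst Not) w) @ w, []) \<in> fg_rel X"
  using assms
proof (induction w)
  case Nil
  then show ?case by (auto intro: fg_rel.refl)
next
  case (Cons a w)
  obtain b x where a: "a = (b, x)" by force
  let ?i = "rev (map (apfst Not) w)"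
  have "(?i @ [(\<not> b, x), (\<not> \<not> b, x)] @ w, ?i @ w) \<in> fg_rel X"
    using Cons a by (intro fg_rel.cancel) auto
  then show ?case
    using Cons a by (auto intro: fg_rel.trans)
qed

lemma group_free_group: "group (free_group X)"
proof (rule groupI)
  have carr: "\<exists>u\<in>fg_words X. A = fg_rel X `` {u}" if "A \<in> carrier (free_group X)" for A
    using that by (auto simp: free_group_def quotient_def)
  have carrI: "fg_rel X `` {u} \<in> carrier (free_group X)" if "u \<in> fg_words X" for u
    using that by (auto simp: free_group_def quotient_def)
  have one: "\<one>\<^bsub>free_group X\<^esub> = fg_rel X `` {[]}"
    by (simp add: free_group_def)
  show "\<one>\<^bsub>free_group X\<^esub> \<in> carrier (free_group X)"
    by (simp add: one carrI)
  fix A assume "A \<in> carrier (free_group X)"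
  then obtain u where u: "u \<in> fg_words X" "A = fg_rel X `` {u}"
    using carr by blast
  show "\<one>\<^bsub>free_group X\<^esub> \<otimes>\<^bsub>free_group X\<^esub> A = A"
    using u by (simp add: one free_group_mult_class)
  let ?i = "rev (map (apfst Not) u)"
  have "?i \<in> fg_words X" "fg_rel X `` {?i @ u} = fg_rel X `` {[]}"
    using fg_rel_inverse_word[OF u(1)] equiv_class_eq[OF equiv_fg_rel] by metis+
  then show "\<exists>B\<in>carrier (free_group X). B \<otimes>\<^bsub>free_group X\<^esub> A = \<one>\<^bsub>free_group X\<^esub>"
    using u by (metis carrI free_group_mult_class one)
  fix B assume "B \<in> carrier (free_group X)"
  then obtain v where v: "v \<in> fg_words X" "B = fg_rel X `` {v}"
    using carr by blast
  show "A \<otimes>\<^bsub>free_group X\<^esub> B \<in> carrier (free_group X)"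
    using u v by (simp add: free_group_mult_class carrI)
  fix C assume "C \<in> carrier (free_group X)"
  then obtain w where w: "w \<in> fg_words X" "C = fg_rel X `` {w}"
    using carr by blast
  show "A \<otimes>\<^bsub>free_group X\<^esub> B \<otimes>\<^bsub>free_group X\<^esub> C
      = A \<otimes>\<^bsub>free_group X\<^esub> (B \<otimes>\<^bsub>free_group X\<^esub> C)"
    using u v w by (simp add: free_group_mult_class)
qed

lemma (in group) lower_central_normal: "lower_central G k \<lhd> G"
proof (induction k)
  case 0
  then show ?case by (auto intro!: normal_invI subgroup_self)
next
  case (Suc k)
  interpret N: normal "lower_central G k" G by (rule Suc)
  have "x \<otimes> (h \<otimes> g \<otimes> inv h \<otimes> inv g) \<otimes> inv x
      = (x \<otimes> h \<otimes> inv x) \<otimes> (x \<otimes> g \<otimes> inv x) \<otimes> inv (x \<otimes> h \<otimes> inv x) \<otimes> inv (x \<otimes> g \<otimes> inv x)"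
    if "x \<in> carrier G" "h \<in> carrier G" "g \<in> carrier G" for x h g
  proof -
    have "inv x \<otimes> (x \<otimes> y) = y" if "y \<in> carrier G" for y
      using that \<open>x \<in> carrier G\<close> by (simp add: m_assoc[symmetric])
    then show ?thesis
      using that by (simp add: inv_mult_group m_assoc)
  qed
  then show ?case
    unfolding lower_central.simps
    by (intro normal_generateI) (auto intro!: N.inv_op_closed2 bexI)
qed

lemma group_free_nilpotent_group: "group (free_nilpotent_group n r)"
  unfolding free_nilpotent_group_def
  by (intro normal.factorgroup_is_group group.lower_central_normal group_free_group)

end

theory Submission
  imports Defs
begin

text \<open>
  In a group \<open>G\<close> whose derived subgroup is central, an IA-automorphism \<open>\<phi>\<close> moves every \<open>z\<close> by a
  central factor \<open>c z = z\<inverse> (\<phi> z)\<close>. Centrality makes \<open>c\<close> multiplicative: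
  \<open>c (z w) = w\<inverse> (c z) (\<phi> w) = (c z) (c w)\<close>. Hence the twisted conjugacy class of the unit, being
  the range of the homomorphism \<open>c\<close>, is a subgroup (\<open>subgroup_twisted_class_one\<close>).

  A free nilpotent group of class two is a quotient \<open>G Mod \<gamma>\<^sub>3(G)\<close>, and dividing out \<open>\<gamma>\<^sub>3(G)\<close>
  makes the derived subgroup central (\<open>derived_Mod_lower_central_2_central\<close>).
\<close>

text \<open>
  The derived subgroup of the quotient is the image of \<open>\<gamma>\<^sub>2(G)\<close>, and the commutator of an element
  of \<open>\<gamma>\<^sub>2(G)\<close> with any element of \<open>G\<close> is one of the generators of \<open>\<gamma>\<^sub>3(G)\<close>, which the quotient kills.
\<close>

lemma (in group) derived_Mod_lower_central_2_central:
  defines "Q \<equiv> G Mod lower_central G 2"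
  assumes d: "d \<in> derived Q (carrier Q)" and q: "q \<in> carrier Q"
  shows "d \<otimes>\<^bsub>Q\<^esub> q = q \<otimes>\<^bsub>Q\<^esub> d"
proof -
  define N where "N = lower_central G 2"
  interpret N: normal N G
    unfolding N_def by (rule lower_central_normal)
  interpret \<pi>: group_hom G Q "\<lambda>a. N #> a"
    using N.factorgroup_is_group N.r_coset_hom_Mod
    by (intro group_hom.intro group_hom_axioms.intro is_group) (simp_all add: Q_def N_def)
  have carr: "carrier Q = (\<lambda>a. N #> a) ` carrier G"
    by (auto simp: Q_def N_def FactGroup_def RCOSETS_def)
  have "derived G (carrier G) = lower_central G 1"
    by (simp add: derived_def)
  then have "derived Q (carrier Q) = (\<lambda>a. N #> a) ` lower_central G 1"
    using \<pi>.derived_img[of "carrier G"] carr by simp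
  with d q carr obtain a b
    where a: "a \<in> lower_central G 1" "d = N #> a" and b: "b \<in> carrier G" "q = N #> b"
    by auto
  have aG: "a \<in> carrier G"
    by (rule subgroup.mem_carrier[OF normal_imp_subgroup[OF lower_central_normal] a(1)])
  have "a \<otimes> b \<otimes> inv a \<otimes> inv b \<in> N"
    using a(1) b(1) unfolding N_def numeral_2_eq_2 One_nat_def lower_central.simps(2)[of _ "Suc 0"]
    by (blast intro: generate.incl)
  moreover have "(a \<otimes> b \<otimes> inv a \<otimes> inv b) \<otimes> (b \<otimes> a) = a \<otimes> b"
  proof -
    have "inv x \<otimes> (x \<otimes> y) = y" if "x \<in> carrier G" "y \<in> carrier G" for x y
      using that by (simp add: m_assoc[symmetric])
    then show ?thesis
      using aG b(1) by (simp add: m_assoc)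
  qed
  ultimately have "a \<otimes> b \<in> N #> (b \<otimes> a)"
    unfolding r_coset_def by force
  then have "N #> (a \<otimes> b) = N #> (b \<otimes> a)"
    by (rule repr_independence[OF _ m_closed[OF b(1) aG] N.subgroup_axioms, symmetric])
  then show ?thesis
    using a(2) b aG \<pi>.hom_mult by simp
qed

text \<open>
  Write \<open>G'\<close> for the derived subgroup. Its centrality is used twice: it turns the coset
  condition \<open>\<phi> z \<in> G' z\<close> into \<open>z\<inverse> (\<phi> z) \<in> G'\<close>, and it lets the factor \<open>z\<inverse> (\<phi> z)\<close> pass
  \<open>w\<inverse>\<close>, which makes \<open>z \<mapsto> z\<inverse> (\<phi> z)\<close> a homomorphism.
\<close>

lemma (in group) subgroup_twisted_class_one:
  assumes IA: "IA_automorphism G \<phi>"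
    and central: "\<And>d g. d \<in> derived G (carrier G) \<Longrightarrow> g \<in> carrier G \<Longrightarrow> d \<otimes> g = g \<otimes> d"
  shows "subgroup (twisted_class_one G \<phi>) G"
proof -
  define c where "c = (\<lambda>z. inv z \<otimes> \<phi> z)"
  have \<phi>_hom: "\<phi> \<in> hom G G"
    using IA by (simp add: IA_automorphism_def iso_def)
  have \<phi>_closed: "\<phi> z \<in> carrier G" if "z \<in> carrier G" for z
    using \<phi>_hom that by (rule hom_in_carrier)
  have D_sub: "derived G (carrier G) \<subseteq> carrier G"
    by (simp add: derived_in_carrier)
  have c_derived: "c z \<in> derived G (carrier G)" if z: "z \<in> carrier G" for z
  proof -
    have "\<phi> z \<in> derived G (carrier G) #> z"
      using IA z repr_independenceD[OF derived_is_subgroup[OF subset_refl] \<phi>_closed[OF z], of z]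
      by (simp add: IA_automorphism_def)
    then obtain d where d: "d \<in> derived G (carrier G)" "\<phi> z = d \<otimes> z"
      unfolding r_coset_def by auto
    have "c z = inv z \<otimes> (z \<otimes> d)"
      using central[OF d(1) z] d(2) by (simp add: c_def)
    then have "c z = d"
      using d(1) D_sub z by (auto simp: m_assoc[symmetric])
    with d(1) show ?thesis by simp
  qed
  have "c \<in> hom G G"
  proof (rule homI)
    fix z w assume z: "z \<in> carrier G" and w: "w \<in> carrier G"
    have cz: "c z \<in> carrier G"
      using c_derived[OF z] D_sub by blast
    have "c (z \<otimes> w) = inv w \<otimes> c z \<otimes> \<phi> w"
      using z w \<phi>_closed by (simp add: c_def hom_mult[OF \<phi>_hom] inv_mult_group m_assoc)
    also have "\<dots> = c z \<otimes> inv w \<otimes> \<phi> w"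
      using central[OF c_derived[OF z], of "inv w"] w by simp
    also have "\<dots> = c z \<otimes> c w"
      using cz w \<phi>_closed by (simp add: c_def m_assoc)
    finally show "c (z \<otimes> w) = c z \<otimes> c w" .
  qed (simp add: c_def \<phi>_closed)
  then interpret c: group_hom G G c
    by (intro group_hom.intro group_hom_axioms.intro is_group)
  have "twisted_class_one G \<phi> = c ` carrier G"
    by (auto simp: twisted_class_one_def c_def)
  then show ?thesis
    using c.img_is_subgroup by simp
qed

theorem corollary5:
  fixes n :: nat
  assumes "IA_automorphism (free_nilpotent_group n 2) \<phi>"
  shows "subgroup (twisted_class_one (free_nilpotent_group n 2) \<phi>) (free_nilpotent_group n 2)"
  using group.subgroup_twisted_class_one[OF group_free_nilpotent_group assms]
    group.derived_Mod_lower_central_2_central[OF group_free_group]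
  unfolding free_nilpotent_group_def by blast

end
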